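(* For every maximal configuration $x_0$ of $[\![C]\!]$, if $x_0$ has a covering chain $\emptyset\subset x_1\subset\cdots\subset x_n=x_0$ whose sequence of added events (read through their labels) is the word $\omega_0$, then $C \twoheadrightarrow v(x_0)\cdot(\omega_0,\checkmark) + \sum_k p_k\cdot(\omega_k, C_k)$ for some $\omega_k, p_k, C_k$, where $v$ is the configuration-valuation of $[\![C]\!]$.
   Context: Commands: $C ::= \mathtt{skip} \mid a\in Act \mid C;C \mid C \oplus_p C \mid C\parallel C$ with $p\in(0,1)$. Labels are $Act\cup\{sk\}\cup\{\tau\}$ ($\tau$ an invisible step). Small steps go from a command to a finite probability distribution over pairs (label, command or $\checkmark$): $\mathtt{skip}\to 1\cdot(sk,\checkmark)$, $a\to 1\cdot(a,\checkmark)$, $C_1\oplus_p C_2\to p\cdot(\tau,C_1)+(1-p)\cdot(\tau,C_2)$; for $C_1;C_2$: if $C_1\to1\cdot(l,\checkmark)$ then $C_1;C_2\to1\cdot(l,C_2)$, if $C_1\to 1\cdot(l,C_1')$ then $C_1;C_2\to 1\cdot(l,C_1';C_2)$, if $C_1\to\sum_i p_i(\tau,C_i)$ then $C_1;C_2\to\sum_i p_i(\tau,C_i;C_2)$; $C_1\parallel C_2$ analogously lets either side move (a side that reaches $\checkmark$ is removed). The multi-step relation: if $C\to\sum_i p_i(l,C_i)$ then $C\twoheadrightarrow\sum_i p_i(l,C_i)$; and if moreover each $C_i\twoheadrightarrow\sum_j p_j(\omega_{ij},C_{ij})$ then $C\twoheadrightarrow\sum_i p_i\sum_j p_j(l:\omega_{ij},C_{ij})$.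 A probabilistic event structure is an event structure $(E,\le,\#)$ (partial order with finite down-closures, hereditary irreflexive symmetric conflict; configurations are conflict-free down-closed sets) with a valuation $v$ on finite configurations, $v(\emptyset)=1$, satisfying $v(y)-\sum_{\emptyset\ne I\subseteq\{1..n\}}(-1)^{|I|+1}v(\bigcup_{i\in I}x_i)\ge0$ for $y\subseteq x_1,\dots,x_n$ ($v=0$ on non-configurations). Interpretation $[\![C]\!]$: $[\![\mathtt{skip}]\!]$, $[\![a]\!]$ are one-event structures with valuation 1; $[\![C_1;C_2]\!]$ has events $E_1\uplus(E_2\times$ maximal configurations of $[\![C_1]\!])$ with $e_1\le(e_2,x)$ for $e_1\in x$, and $v(x)=v_1(x)$ on configurations of $[\![C_1]\!]$, $v(x_1\cup(x_2\times\{x_1\}))=v_1(x_1)v_2(x_2)$; $[\![C_1\oplus_p C_2]\!]$ adds an initial event $\tau$ below everything, puts all events of the two sides in mutual conflict, and $v(x)=p\,v_1(x\setminus\tau)$ or $(1-p)v_2(x\setminus\tau)$, with $v(\emptyset)=v(\{\tau\})=1$; $[\![C_1\parallel C_2]\!]$ is the disjoint union with $v(x)=v_1(x\cap E_1)v_2(x\cap E_2)$. A covering chain of $x$ is a chain $\emptyset\subset x_1\subset\cdots\subset x_n=x$ of configurations each adding one event; events carry labels. *)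

theory Defs
  imports "HOL-Probability.Probability"
begin

section \<open>Commands and operational semantics\<close>

typedef prob = "{p :: real. 0 < p \<and> p < 1}"
  morphisms weight Prob
  by (rule exI[of _ "1/2"]) simp

datatype 'a cmd =
    Skip
  | Atom 'a
  | Seq "'a cmd" "'a cmd"
  | Choice prob "'a cmd" "'a cmd"
  | Par "'a cmd" "'a cmd"

datatype 'a label = Act 'a | Sk | Tau

text \<open>
  In a target of type \<open>'a cmd option\<close>, \<open>None\<close> is the terminated computation (the check mark)
  and \<open>Some C\<close> is the remaining command. A transition to \<open>1 \<cdot> z\<close> is a transition to \<open>return_pmf z\<close>.
  A transition to \<open>\<Sum>i. p\<^sub>i \<cdot> (\<tau>, C\<^sub>i)\<close> is one to \<open>map_pmf (\<lambda>D. (Tau, Some D)) \<nu>\<close>, where \<open>\<nu>\<close> is the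
  distribution \<open>\<Sum>i. p\<^sub>i \<cdot> C\<^sub>i\<close>. All distributions reached by \<open>step\<close> and \<open>multi\<close> have finite support.
\<close>

inductive step :: "'a cmd \<Rightarrow> ('a label \<times> 'a cmd option) pmf \<Rightarrow> bool" where
  step_Skip: "step Skip (return_pmf (Sk, None))"
| step_Atom: "step (Atom a) (return_pmf (Act a, None))"
| step_Choice: "step (Choice p C1 C2)
    (pmf_of_list [((Tau, Some C1), weight p), ((Tau, Some C2), 1 - weight p)])"
| step_Seq_end: "step C1 (return_pmf (l, None)) \<Longrightarrow>
    step (Seq C1 C2) (return_pmf (l, Some C2))"
| step_Seq: "step C1 (return_pmf (l, Some C1')) \<Longrightarrow>
    step (Seq C1 C2) (return_pmf (l, Some (Seq C1' C2)))"
| step_Seq_Tau: "step C1 (map_pmf (\<lambda>D. (Tau, Some D)) \<nu>) \<Longrightarrow>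
    step (Seq C1 C2) (map_pmf (\<lambda>D. (Tau, Some (Seq D C2))) \<nu>)"
| step_ParL_end: "step C1 (return_pmf (l, None)) \<Longrightarrow>
    step (Par C1 C2) (return_pmf (l, Some C2))"
| step_ParL: "step C1 (return_pmf (l, Some C1')) \<Longrightarrow>
    step (Par C1 C2) (return_pmf (l, Some (Par C1' C2)))"
| step_ParL_Tau: "step C1 (map_pmf (\<lambda>D. (Tau, Some D)) \<nu>) \<Longrightarrow>
    step (Par C1 C2) (map_pmf (\<lambda>D. (Tau, Some (Par D C2))) \<nu>)"
| step_ParR_end: "step C2 (return_pmf (l, None)) \<Longrightarrow>
    step (Par C1 C2) (return_pmf (l, Some C1))"
| step_ParR: "step C2 (return_pmf (l, Some C2')) \<Longrightarrow>
    step (Par C1 C2) (return_pmf (l, Some (Par C1 C2')))"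
| step_ParR_Tau: "step C2 (map_pmf (\<lambda>D. (Tau, Some D)) \<nu>) \<Longrightarrow>
    step (Par C1 C2) (map_pmf (\<lambda>D. (Tau, Some (Par C1 D))) \<nu>)"

text \<open>
  In rule \<open>multi_trans\<close>, \<open>\<nu>\<close> is a distribution on the indices \<open>i\<close> of the sum \<open>\<Sum>i. p\<^sub>i \<cdot> (l, C\<^sub>i)\<close>
  and \<open>\<kappa> i\<close> is the distribution \<open>\<Sum>j. p\<^sub>j \<cdot> (\<omega>\<^sub>i\<^sub>j, C\<^sub>i\<^sub>j)\<close>. The indices allow equal summands to be
  continued differently. Since the check mark has no multi-step, every \<open>C\<^sub>i\<close> in this rule is a
  command.
\<close>

inductive multi :: "'a cmd \<Rightarrow> ('a label list \<times> 'a cmd option) pmf \<Rightarrow> bool" where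
  multi_step: "step C (map_pmf (\<lambda>c. (l, c)) \<nu>) \<Longrightarrow>
    multi C (map_pmf (\<lambda>c. ([l], c)) \<nu>)"
| multi_trans: "step C (map_pmf (\<lambda>i. (l, Some (D i))) \<nu>) \<Longrightarrow> finite (set_pmf \<nu>) \<Longrightarrow>
    (\<And>i. i \<in> set_pmf \<nu> \<Longrightarrow> multi (D i) (\<kappa> i)) \<Longrightarrow>
    multi C (bind_pmf (\<nu> :: nat pmf) (\<lambda>i. map_pmf (\<lambda>(\<omega>, c). (l # \<omega>, c)) (\<kappa> i)))"


section \<open>Probabilistic event structures\<close>

record ('e, 'l) es =
  events :: "'e set"
  leq :: "('e \<times> 'e) set"
  cfl :: "('e \<times> 'e) set"
  lab :: "'e \<Rightarrow> 'l"

definition event_structure :: "('e, 'l) es \<Rightarrow> bool" where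
  "event_structure S \<longleftrightarrow>
     leq S \<subseteq> events S \<times> events S \<and> refl_on (events S) (leq S) \<and> trans (leq S) \<and> antisym (leq S) \<and>
     (\<forall>e \<in> events S. finite {d. (d, e) \<in> leq S}) \<and>
     cfl S \<subseteq> events S \<times> events S \<and> irrefl (cfl S) \<and> sym (cfl S) \<and>
     (\<forall>e d d'. (e, d) \<in> cfl S \<longrightarrow> (d, d') \<in> leq S \<longrightarrow> (e, d') \<in> cfl S)"

definition configuration :: "('e, 'l) es \<Rightarrow> 'e set \<Rightarrow> bool" where
  "configuration S x \<longleftrightarrow>
     x \<subseteq> events S \<and>
     (\<forall>e \<in> x. \<forall>d. (d, e) \<in> leq S \<longrightarrow> d \<in> x) \<and>
     (\<forall>e \<in> x. \<forall>d \<in> x. (e, d) \<notin> cfl S)"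

definition maximal_configuration :: "('e, 'l) es \<Rightarrow> 'e set \<Rightarrow> bool" where
  "maximal_configuration S x \<longleftrightarrow>
     configuration S x \<and> (\<forall>y. configuration S y \<longrightarrow> x \<subseteq> y \<longrightarrow> y = x)"

text \<open>\<open>covering_chain S es x\<close>: there is a chain \<open>\<emptyset> = X\<^sub>0 \<subset> X\<^sub>1 \<subset> \<dots> \<subset> X\<^sub>n = x\<close> of configurations such
  that \<open>X\<^sub>i\<^sub>+\<^sub>1\<close> adds the single event \<open>es ! i\<close> to \<open>X\<^sub>i\<close>.\<close>

definition covering_chain :: "('e, 'l) es \<Rightarrow> 'e list \<Rightarrow> 'e set \<Rightarrow> bool" where
  "covering_chain S es x \<longleftrightarrow>
     (\<exists>X. X 0 = {} \<and> X (length es) = x \<and>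
        (\<forall>i \<le> length es. configuration S (X i)) \<and>
        (\<forall>i < length es. es ! i \<notin> X i \<and> X (Suc i) = insert (es ! i) (X i)))"

text \<open>The interpretation of every command below is a probabilistic event structure in this sense, so
  this is a property of the construction and not an assumption on it.\<close>

definition prob_event_structure :: "('e, 'l) es \<Rightarrow> ('e set \<Rightarrow> real) \<Rightarrow> bool" where
  "prob_event_structure S v \<longleftrightarrow>
     event_structure S \<and>
     v {} = 1 \<and>
     (\<forall>x. \<not> (configuration S x \<and> finite x) \<longrightarrow> v x = 0) \<and>
     (\<forall>y (n :: nat) x.
        configuration S y \<and> finite y \<and>
        (\<forall>i \<in> {1..n}. configuration S (x i) \<and> finite (x i) \<and> y \<subseteq> x i) \<longrightarrow>
        v y - (\<Sum>I | I \<subseteq> {1..n} \<and> I \<noteq> {}. (- 1) ^ (card I + 1) * v (\<Union>i \<in> I. x i)) \<ge> 0)"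


section \<open>Interpretation of commands\<close>

text \<open>
  One type of events for all commands: \<open>Pt\<close> is the event of \<open>Skip\<close> and \<open>Atom\<close>, \<open>Init\<close> the initial
  event of a choice, \<open>L\<close> and \<open>R\<close> tag the events of the two components, and \<open>After e x\<close> is the
  pair \<open>(e, x)\<close> of an event of the second component of a sequential composition and a maximal
  configuration of the first. The interpretation of a command has finitely many events, so
  every configuration of it is \<open>fset x\<close> for some \<open>x\<close>.
\<close>

datatype ev = Pt | Init | L ev | R ev | After ev "ev fset"

definition es_point :: "'l \<Rightarrow> (ev, 'l) es" where
  "es_point l = \<lparr>events = {Pt}, leq = {(Pt, Pt)}, cfl = {}, lab = (\<lambda>_. l)\<rparr>"

text \<open>Conflict is the hereditary closure of the conflict of the first component and of the
  conflict inside each copy of the second. Events of different copies are in conflict because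
  two different maximal configurations contain conflicting events.\<close>

definition es_seq :: "(ev, 'l) es \<Rightarrow> (ev, 'l) es \<Rightarrow> (ev, 'l) es" where
  "es_seq S1 S2 =
    \<lparr>events = L ` events S1 \<union>
       {After e x |e x. e \<in> events S2 \<and> maximal_configuration S1 (fset x)},
     leq = {(L d, L e) |d e. (d, e) \<in> leq S1} \<union>
       {(L d, After e x) |d e x. d |\<in>| x \<and> e \<in> events S2 \<and> maximal_configuration S1 (fset x)} \<union>
       {(After d x, After e x) |d e x. (d, e) \<in> leq S2 \<and> maximal_configuration S1 (fset x)},
     cfl = {(L d, L e) |d e. (d, e) \<in> cfl S1} \<union>
       {(L d, After e x) |d e x. e \<in> events S2 \<and> maximal_configuration S1 (fset x) \<and>
          (\<exists>c. c |\<in>| x \<and> (d, c) \<in> cfl S1)} \<union>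
       {(After e x, L d) |d e x. e \<in> events S2 \<and> maximal_configuration S1 (fset x) \<and>
          (\<exists>c. c |\<in>| x \<and> (c, d) \<in> cfl S1)} \<union>
       {(After d x, After e y) |d e x y. d \<in> events S2 \<and> e \<in> events S2 \<and>
          maximal_configuration S1 (fset x) \<and> maximal_configuration S1 (fset y) \<and>
          (\<exists>b c. b |\<in>| x \<and> c |\<in>| y \<and> (b, c) \<in> cfl S1)} \<union>
       {(After d x, After e x) |d e x. (d, e) \<in> cfl S2 \<and> maximal_configuration S1 (fset x)},
     lab = (\<lambda>e. case e of L d \<Rightarrow> lab S1 d | After d x \<Rightarrow> lab S2 d | _ \<Rightarrow> undefined)\<rparr>"

definition es_choice :: "(ev, 'a label) es \<Rightarrow> (ev, 'a label) es \<Rightarrow> (ev, 'a label) es" where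
  "es_choice S1 S2 =
    \<lparr>events = {Init} \<union> L ` events S1 \<union> R ` events S2,
     leq = {(Init, Init)} \<union> {Init} \<times> (L ` events S1 \<union> R ` events S2) \<union>
       {(L d, L e) |d e. (d, e) \<in> leq S1} \<union> {(R d, R e) |d e. (d, e) \<in> leq S2},
     cfl = {(L d, L e) |d e. (d, e) \<in> cfl S1} \<union> {(R d, R e) |d e. (d, e) \<in> cfl S2} \<union>
       (L ` events S1) \<times> (R ` events S2) \<union> (R ` events S2) \<times> (L ` events S1),
     lab = (\<lambda>e. case e of Init \<Rightarrow> Tau | L d \<Rightarrow> lab S1 d | R d \<Rightarrow> lab S2 d | _ \<Rightarrow> undefined)\<rparr>"

definition es_par :: "(ev, 'l) es \<Rightarrow> (ev, 'l) es \<Rightarrow> (ev, 'l) es" where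
  "es_par S1 S2 =
    \<lparr>events = L ` events S1 \<union> R ` events S2,
     leq = {(L d, L e) |d e. (d, e) \<in> leq S1} \<union> {(R d, R e) |d e. (d, e) \<in> leq S2},
     cfl = {(L d, L e) |d e. (d, e) \<in> cfl S1} \<union> {(R d, R e) |d e. (d, e) \<in> cfl S2},
     lab = (\<lambda>e. case e of L d \<Rightarrow> lab S1 d | R d \<Rightarrow> lab S2 d | _ \<Rightarrow> undefined)\<rparr>"

primrec interp_es :: "'a cmd \<Rightarrow> (ev, 'a label) es" where
  "interp_es Skip = es_point Sk"
| "interp_es (Atom a) = es_point (Act a)"
| "interp_es (Seq C1 C2) = es_seq (interp_es C1) (interp_es C2)"
| "interp_es (Choice p C1 C2) = es_choice (interp_es C1) (interp_es C2)"
| "interp_es (Par C1 C2) = es_par (interp_es C1) (interp_es C2)"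

definition on_configurations :: "('e, 'l) es \<Rightarrow> ('e set \<Rightarrow> real) \<Rightarrow> 'e set \<Rightarrow> real" where
  "on_configurations S v x = (if configuration S x then v x else 0)"

text \<open>In the sequential case, a configuration that is not contained in the first component has
  the form \<open>x\<^sub>1 \<union> (x\<^sub>2 \<times> {x\<^sub>1})\<close>, and the two factors are evaluated at \<open>x\<^sub>1\<close> and \<open>x\<^sub>2\<close>.\<close>

primrec interp_val :: "'a cmd \<Rightarrow> ev set \<Rightarrow> real" where
  "interp_val Skip = on_configurations (interp_es (Skip :: 'a cmd)) (\<lambda>_. 1)"
| "interp_val (Atom a) = on_configurations (interp_es (Atom a)) (\<lambda>_. 1)"
| "interp_val (Seq C1 C2) = on_configurations (interp_es (Seq C1 C2))
     (\<lambda>x. if x \<subseteq> range L then interp_val C1 (L -` x)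
          else interp_val C1 (L -` x) * interp_val C2 {e. \<exists>y. After e y \<in> x})"
| "interp_val (Choice p C1 C2) = on_configurations (interp_es (Choice p C1 C2))
     (\<lambda>x. if x \<subseteq> {Init} then 1
          else if x \<subseteq> insert Init (range L) then weight p * interp_val C1 (L -` x)
          else (1 - weight p) * interp_val C2 (R -` x))"
| "interp_val (Par C1 C2) = on_configurations (interp_es (Par C1 C2))
     (\<lambda>x. interp_val C1 (L -` x) * interp_val C2 (R -` x))"

end

theory Submission
  imports Defs
begin

text \<open>
  Complete runs of a command and their probabilities are defined compositionally by the
  predicate \<open>run\<close>: concatenation for sequences, shuffles for parallel composition. A covering chain
  of a maximal configuration decomposes along the structure of the command, so its word is a run with
  the probability given by the valuation. Conversely, a run can be peeled off one label at a
  time, each label being matched by a small step to a command that has the rest of the run. The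
  other branches of a probabilistic step cannot stay idle in a multi-step, but they can always do
  some step.
\<close>

section \<open>Runs\<close>

text \<open>The real number is the value of a single run. A word can have several runs with
  different values, as in a choice between equal commands, so the value is not a function of the
  word.\<close>

inductive run :: "'a cmd \<Rightarrow> 'a label list \<Rightarrow> real \<Rightarrow> bool" where
  run_Skip: "run Skip [Sk] 1"
| run_Atom: "run (Atom a) [Act a] 1"
| run_Seq: "run C1 w1 v1 \<Longrightarrow> run C2 w2 v2 \<Longrightarrow> run (Seq C1 C2) (w1 @ w2) (v1 * v2)"
| run_ChoiceL: "run C1 w v \<Longrightarrow> run (Choice p C1 C2) (Tau # w) (weight p * v)"
| run_ChoiceR: "run C2 w v \<Longrightarrow> run (Choice p C1 C2) (Tau # w) ((1 - weight p) * v)"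
| run_Par: "run C1 w1 v1 \<Longrightarrow> run C2 w2 v2 \<Longrightarrow> w \<in> shuffles w1 w2 \<Longrightarrow>
    run (Par C1 C2) w (v1 * v2)"

section \<open>Bounds on run values and available small steps\<close>

lemma weight_bounds: "0 < weight p" "weight p < 1"
  using weight[of p] by auto

lemma run_nonneg: "run C w v \<Longrightarrow> 0 \<le> v"
  by (induction rule: run.induct) (auto simp: less_imp_le weight_bounds)

text \<open>The lifting rules of \<open>step\<close> and the case \<open>prob\<close> of
  \<open>run_step\<close> need the target as an image of a distribution on commands. The masses are
  only bounded from below because the two list entries merge when \<open>C1 = C2\<close>.\<close>

lemma step_Choice_map:
  fixes C1 C2 :: "'a cmd" and p :: prob
  defines "\<nu> \<equiv> pmf_of_list [(C1, weight p), (C2, 1 - weight p)]"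
  shows "step (Choice p C1 C2) (map_pmf (\<lambda>D. (Tau, Some D)) \<nu>)" "finite (set_pmf \<nu>)"
    "weight p \<le> pmf \<nu> C1" "1 - weight p \<le> pmf \<nu> C2"
proof -
  have wf: "pmf_of_list_wf [(C1, weight p), (C2, 1 - weight p)]"
    using weight_bounds[of p] by (auto simp: pmf_of_list_wf_def)
  have wf': "pmf_of_list_wf [((Tau :: 'a label, Some C1), weight p), ((Tau, Some C2), 1 - weight p)]"
    using weight_bounds[of p] by (auto simp: pmf_of_list_wf_def)
  have "map_pmf (\<lambda>D. (Tau :: 'a label, Some D)) \<nu> =
      pmf_of_list [((Tau, Some C1), weight p), ((Tau, Some C2), 1 - weight p)]"
  proof (rule pmf_eqI)
    fix z :: "'a label \<times> 'a cmd option"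
    have "pmf (map_pmf (\<lambda>D. (Tau, Some D)) \<nu>) z =
        measure (measure_pmf \<nu>) ((\<lambda>D. (Tau, Some D)) -` {z})"
      by (simp add: pmf_map)
    also have "\<dots> = pmf (pmf_of_list [((Tau, Some C1), weight p), ((Tau, Some C2), 1 - weight p)]) z"
      unfolding \<nu>_def by (auto simp: measure_pmf_of_list[OF wf] pmf_pmf_of_list[OF wf'])
    finally show "pmf (map_pmf (\<lambda>D. (Tau, Some D)) \<nu>) z =
        pmf (pmf_of_list [((Tau, Some C1), weight p), ((Tau, Some C2), 1 - weight p)]) z" .
  qed
  then show "step (Choice p C1 C2) (map_pmf (\<lambda>D. (Tau, Some D)) \<nu>)"
    using step_Choice[of p C1 C2] by simp
  show "finite (set_pmf \<nu>)"
    unfolding \<nu>_def using finite_set_pmf_of_list[OF wf] .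
  show "weight p \<le> pmf \<nu> C1" "1 - weight p \<le> pmf \<nu> C2"
    unfolding \<nu>_def using weight_bounds[of p] by (auto simp: pmf_pmf_of_list[OF wf])
qed

text \<open>Supplies a step for the branches that a given run does not follow. A sequence moves
  through its first component, and for a parallel composition the left component is enough.\<close>

lemma step_progress:
  obtains (final) l where "step C (return_pmf (l, None))"
  | (det) l C' where "step C (return_pmf (l, Some C'))"
  | (prob) \<nu> where "step C (map_pmf (\<lambda>D. (Tau, Some D)) \<nu>)" "finite (set_pmf \<nu>)"
proof (induction C arbitrary: thesis)
  case Skip
  then show ?case using step_Skip by metis
next
  case (Atom a)
  then show ?case using step_Atom by metis
next
  case (Seq C1 C2)
  show ?case
  proof (cases rule: Seq.IH(1))
    case (1 l)
    then show ?thesis using step_Seq_end Seq.prems(2) by blast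
  next
    case (2 l C')
    then show ?thesis using step_Seq Seq.prems(2) by blast
  next
    case (3 \<nu>)
    then show ?thesis
      using step_Seq_Tau[of C1 \<nu> C2] Seq.prems(3)[of "map_pmf (\<lambda>D. Seq D C2) \<nu>"]
      by (simp add: pmf.map_comp o_def)
  qed
next
  case (Choice p C1 C2)
  then show ?case using step_Choice_map[where p = p and ?C1.0 = C1 and ?C2.0 = C2] by metis
next
  case (Par C1 C2)
  show ?case
  proof (cases rule: Par.IH(1))
    case (1 l)
    then show ?thesis using step_ParL_end Par.prems(2) by blast
  next
    case (2 l C')
    then show ?thesis using step_ParL Par.prems(2) by blast
  next
    case (3 \<nu>)
    then show ?thesis
      using step_ParL_Tau[of C1 \<nu> C2] Par.prems(3)[of "map_pmf (\<lambda>D. Par D C2) \<nu>"]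
      by (simp add: pmf.map_comp o_def)
  qed
qed

text \<open>In \<open>prob\<close>, the inequality can be strict if several branches lead to \<open>D\<close>, since they are merged
  in \<open>\<nu>\<close>.\<close>

inductive run_step :: "'a cmd \<Rightarrow> 'a label list \<Rightarrow> real \<Rightarrow> bool" where
  final: "step C (return_pmf (l, None)) \<Longrightarrow> run_step C [l] 1"
| det: "step C (return_pmf (l, Some C')) \<Longrightarrow> run C' w v \<Longrightarrow> run_step C (l # w) v"
| prob: "step C (map_pmf (\<lambda>D. (Tau, Some D)) \<nu>) \<Longrightarrow> finite (set_pmf \<nu>) \<Longrightarrow>
    D \<in> set_pmf \<nu> \<Longrightarrow> run D w v' \<Longrightarrow> v \<le> pmf \<nu> D * v' \<Longrightarrow> run_step C (Tau # w) v"

section \<open>Lifting the first step of a run through sequences and parallel compositions\<close>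

lemma pmf_le_map_pmf: "pmf \<nu> D \<le> pmf (map_pmf f \<nu>) (f D)"
  unfolding pmf_map by (simp add: measure_pmf_single[symmetric] measure_pmf.finite_measure_mono)

text \<open>\<open>K\<close> stands for the context around the moving component, \<open>v2\<close>
  for the value of the waiting one. Taking the image under \<open>K\<close> can only collect mass at
  \<open>K D\<close>, and nonnegative values turn this into the required bound.\<close>

lemma run_step_prob_context:
  assumes "step C (map_pmf (\<lambda>D. (Tau, Some (K D))) \<nu>)" "finite (set_pmf \<nu>)" "D \<in> set_pmf \<nu>"
    and run: "run (K D) w (v' * v2)" and v: "v1 \<le> pmf \<nu> D * v'" and "0 \<le> v2"
  shows "run_step C (Tau # w) (v1 * v2)"
proof (rule run_step.prob)
  show "step C (map_pmf (\<lambda>D. (Tau, Some D)) (map_pmf K \<nu>))"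
    using assms(1) by (simp add: pmf.map_comp o_def)
  have "v1 * v2 \<le> pmf \<nu> D * (v' * v2)"
    using mult_right_mono[OF v \<open>0 \<le> v2\<close>] by (simp add: mult.assoc)
  also have "\<dots> \<le> pmf (map_pmf K \<nu>) (K D) * (v' * v2)"
    using run_nonneg[OF run] by (intro mult_right_mono pmf_le_map_pmf)
  finally show "v1 * v2 \<le> pmf (map_pmf K \<nu>) (K D) * (v' * v2)" .
qed (use assms in auto)

lemma run_step_Seq:
  assumes "run_step C1 w1 v1" "run C2 w2 v2"
  shows "run_step (Seq C1 C2) (w1 @ w2) (v1 * v2)"
  using assms(1)
proof cases
  case (final l)
  then show ?thesis using assms(2) by (auto intro: run_step.det step_Seq_end)
next
  case (det l C' w)
  then show ?thesis using assms(2) by (auto intro: run_step.det step_Seq run_Seq)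
next
  case (prob \<nu> D w v')
  then show ?thesis using assms(2)
    by (auto intro!: run_step_prob_context[of _ "\<lambda>D. Seq D C2" \<nu> D _ v'] step_Seq_Tau run_Seq
        run_nonneg[OF assms(2)])
qed

lemma run_step_ParL:
  assumes "run_step C1 (l # w1) v1" "run C2 w2 v2" "w \<in> shuffles w1 w2"
  shows "run_step (Par C1 C2) (l # w) (v1 * v2)"
  using assms(1)
proof cases
  case final
  then show ?thesis using assms(2,3) by (auto intro: run_step.det step_ParL_end)
next
  case (det C')
  then show ?thesis using assms(2,3) by (auto intro: run_step.det step_ParL run_Par)
next
  case (prob \<nu> D v')
  then show ?thesis using assms(2,3)
    by (auto intro!: run_step_prob_context[of _ "\<lambda>D. Par D C2" \<nu> D _ v'] step_ParL_Tau run_Par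
        run_nonneg[OF assms(2)])
qed

lemma run_step_ParR:
  assumes "run_step C2 (l # w2) v2" "run C1 w1 v1" "w \<in> shuffles w1 w2"
  shows "run_step (Par C1 C2) (l # w) (v1 * v2)"
  using assms(1)
proof cases
  case final
  then show ?thesis using assms(2,3) by (auto intro: run_step.det step_ParR_end)
next
  case (det C')
  then show ?thesis using assms(2,3) by (auto intro: run_step.det step_ParR run_Par)
next
  case (prob \<nu> D v')
  \<comment> \<open>\<open>run_step_prob_context\<close> puts the value of the moving component
    first, so the product appears reversed.\<close>
  have "run_step (Par C1 C2) (Tau # w) (v2 * v1)"
    using run_step_prob_context[OF step_ParR_Tau[OF prob(2)] prob(3,4) _ prob(6)
        run_nonneg[OF assms(2)]] run_Par[OF assms(2) prob(5) assms(3)]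
    by (simp add: mult.commute)
  then show ?thesis using prob by (simp add: mult.commute)
qed

text \<open>By induction on the run. The first letter of a shuffle comes from one of the two words
  and so decides which component moves.\<close>

lemma run_imp_run_step: "run C w v \<Longrightarrow> run_step C w v"
proof (induction rule: run.induct)
  case run_Skip
  show ?case by (intro run_step.final step_Skip)
next
  case (run_Atom a)
  show ?case by (intro run_step.final step_Atom)
next
  case (run_Seq C1 w1 v1 C2 w2 v2)
  then show ?case by (intro run_step_Seq)
next
  case (run_ChoiceL C1 w v p C2)
  \<comment> \<open>Positive mass puts \<open>C1\<close> into the support, as
    \<open>run_step.prob\<close> demands.\<close>
  have "0 < pmf (pmf_of_list [(C1, weight p), (C2, 1 - weight p)]) C1"
    using step_Choice_map(3)[where p = p and ?C1.0 = C1 and ?C2.0 = C2] weight_bounds[of p] by linarith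
  then show ?case
    using run_ChoiceL(1) run_nonneg[OF run_ChoiceL(1)] step_Choice_map[where p = p and ?C1.0 = C1 and ?C2.0 = C2]
    by (intro run_step.prob[where D = C1 and v' = v]) (auto simp: set_pmf_iff intro: mult_right_mono)
next
  case (run_ChoiceR C2 w v p C1)
  have "0 < pmf (pmf_of_list [(C1, weight p), (C2, 1 - weight p)]) C2"
    using step_Choice_map(4)[where p = p and ?C1.0 = C1 and ?C2.0 = C2] weight_bounds[of p] by linarith
  then show ?case
    using run_ChoiceR(1) run_nonneg[OF run_ChoiceR(1)] step_Choice_map[where p = p and ?C1.0 = C1 and ?C2.0 = C2]
    by (intro run_step.prob[where D = C2 and v' = v]) (auto simp: set_pmf_iff intro: mult_right_mono)
next
  case (run_Par C1 w1 v1 C2 w2 v2 w)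
  \<comment> \<open>Every \<open>run_step\<close> word is nonempty, so both components have a first
    label.\<close>
  obtain l1 u1 where w1: "w1 = l1 # u1" using run_Par.IH(1) by cases auto
  obtain l2 u2 where w2: "w2 = l2 # u2" using run_Par.IH(2) by cases auto
  from run_Par.hyps(3) obtain u where
    "w = l1 # u \<and> u \<in> shuffles u1 w2 \<or> w = l2 # u \<and> u \<in> shuffles w1 u2"
    by (auto simp: w1 w2)
  then show ?case
    using run_Par run_step_ParL[of C1 l1 u1 v1 C2 w2 v2 u] run_step_ParR[of C2 l2 u2 v2 C1 w1 v1 u]
    by (auto simp: w1 w2)
qed


section \<open>Runs are multi-steps\<close>

text \<open>One small step is enough. This serves the branches of a probabilistic step that lie off
  the given run, which \<open>multi_trans\<close> has to continue as well.\<close>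

lemma multi_total: "\<exists>M. multi C M \<and> finite (set_pmf M)"
proof (cases C rule: step_progress)
  case (final l)
  then show ?thesis using multi_step[of C l "return_pmf None"] by auto
next
  case (det l C')
  then show ?thesis using multi_step[of C l "return_pmf (Some C')"] by auto
next
  case (prob \<nu>)
  then show ?thesis using multi_step[of C Tau "map_pmf Some \<nu>"]
    by (auto simp: pmf.map_comp o_def)
qed

text \<open>The index type of \<open>multi_trans\<close> is \<open>nat\<close>, so the commands in the support of \<open>\<nu>\<close> are
  enumerated.\<close>

lemma multi_trans_cmd:
  assumes "step C (map_pmf (\<lambda>D. (l, Some D)) \<nu>)" "finite (set_pmf \<nu>)"
    and "\<And>D. D \<in> set_pmf \<nu> \<Longrightarrow> multi D (\<kappa> D)"
  shows "multi C (bind_pmf \<nu> (\<lambda>D. map_pmf (\<lambda>(\<omega>, c). (l # \<omega>, c)) (\<kappa> D)))"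
proof -
  define A where "A = set_pmf \<nu>"
  define f where "f = to_nat_on A"
  define g where "g = from_nat_into A"
  have gf: "g (f D) = D" if "D \<in> set_pmf \<nu>" for D
    using that \<open>finite (set_pmf \<nu>)\<close> by (simp add: f_def g_def A_def countable_finite)
  have "map_pmf (\<lambda>D. (l, Some D)) \<nu> = map_pmf (\<lambda>i. (l, Some (g i))) (map_pmf f \<nu>)"
    by (auto simp: pmf.map_comp gf intro: map_pmf_cong)
  then have "multi C (bind_pmf (map_pmf f \<nu>) (\<lambda>i. map_pmf (\<lambda>(\<omega>, c). (l # \<omega>, c)) (\<kappa> (g i))))"
    using assms by (intro multi_trans[where D = g]) (auto simp: gf)
  also have "bind_pmf (map_pmf f \<nu>) (\<lambda>i. map_pmf (\<lambda>(\<omega>, c). (l # \<omega>, c)) (\<kappa> (g i))) =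
      bind_pmf \<nu> (\<lambda>D. map_pmf (\<lambda>(\<omega>, c). (l # \<omega>, c)) (\<kappa> D))"
    by (auto simp: bind_map_pmf gf intro: bind_pmf_cong)
  finally show ?thesis .
qed

text \<open>Keeping a single branch of the mixture bounds its mass from below.\<close>

lemma pmf_bind_ge:
  assumes "finite (set_pmf \<nu>)" "D \<in> set_pmf \<nu>"
  shows "pmf \<nu> D * pmf (k D) z \<le> pmf (bind_pmf \<nu> k) z"
proof -
  have "pmf (bind_pmf \<nu> k) z = (\<Sum>D\<in>set_pmf \<nu>. pmf \<nu> D * pmf (k D) z)"
    using assms(1) by (simp add: pmf_bind integral_measure_pmf[of "set_pmf \<nu>"])
  moreover have "pmf \<nu> D * pmf (k D) z \<le> (\<Sum>D\<in>set_pmf \<nu>. pmf \<nu> D * pmf (k D) z)"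
    using assms by (intro member_le_sum) auto
  ultimately show ?thesis by simp
qed

text \<open>Induction on the word rather than on the command, since a small step can lead to a
  command that is not a subterm. The bound is an inequality because other branches may produce the
  same word.\<close>

lemma run_imp_multi:
  assumes "run C w v"
  shows "\<exists>M. multi C M \<and> finite (set_pmf M) \<and> v \<le> pmf M (w, None)"
  using assms
proof (induction w arbitrary: C v)
  case Nil
  then show ?case using run_imp_run_step by (fastforce elim: run_step.cases)
next
  case (Cons l w)
  \<comment> \<open>Covers every step to commands; a deterministic step is the case of a point
    mass.\<close>
  have trans: ?case
    if st: "step C (map_pmf (\<lambda>D. (l, Some D)) \<nu>)" and fin: "finite (set_pmf \<nu>)"
      and D: "D \<in> set_pmf \<nu>" and run: "run D w v'" and v: "v \<le> pmf \<nu> D * v'" for \<nu> D v'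
  proof -
    obtain M where M: "multi D M" "finite (set_pmf M)" "v' \<le> pmf M (w, None)"
      using Cons.IH[OF run] by auto
    have "\<exists>\<kappa>. \<forall>D' :: 'a cmd. multi D' (\<kappa> D') \<and> finite (set_pmf (\<kappa> D'))"
      using multi_total by (intro choice) auto
    then obtain \<kappa>' :: "'a cmd \<Rightarrow> _" where \<kappa>': "\<And>D'. multi D' (\<kappa>' D')" "\<And>D'. finite (set_pmf (\<kappa>' D'))"
      by blast
    \<comment> \<open>The branch \<open>D\<close> follows the run through \<open>M\<close>; every
      other branch takes an arbitrary multi-step.\<close>
    define \<kappa> where "\<kappa> = \<kappa>'(D := M)"
    have \<kappa>: "multi D' (\<kappa> D')" "finite (set_pmf (\<kappa> D'))" for D'
      using M \<kappa>' by (auto simp: \<kappa>_def)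
    let ?f = "\<lambda>(\<omega>, c). (l # \<omega>, c :: 'a cmd option)"
    let ?N = "bind_pmf \<nu> (\<lambda>D. map_pmf ?f (\<kappa> D))"
    have "pmf \<nu> D * v' \<le> pmf \<nu> D * pmf (map_pmf ?f (\<kappa> D)) (l # w, None)"
      using M(3) pmf_le_map_pmf[of M "(w, None)" ?f]
      by (intro mult_left_mono) (auto simp: \<kappa>_def)
    also have "\<dots> \<le> pmf ?N (l # w, None)"
      using fin D by (rule pmf_bind_ge)
    finally have "v \<le> pmf ?N (l # w, None)" using v by simp
    moreover have "multi C ?N" using st fin \<kappa>(1) by (rule multi_trans_cmd)
    moreover have "finite (set_pmf ?N)" using fin \<kappa>(2) by auto
    ultimately show ?thesis by blast
  qed
  from run_imp_run_step[OF Cons.prems] show ?case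
  proof cases
    case final
    then show ?thesis using multi_step[of C l "return_pmf None"]
      by (intro exI[of _ "return_pmf ([l], None)"]) auto
  next
    case (det C')
    then show ?thesis by (intro trans[of "return_pmf C'" C' v]) auto
  next
    case (prob \<nu> D v')
    then show ?thesis by (intro trans[of \<nu> D v']) auto
  qed
qed

text \<open>The theorem asks for a summand of weight exactly \<open>v\<close>, so the mass at
  \<open>a\<close> is split: \<open>v\<close> in front, and the surplus \<open>pmf M a - v\<close>
  as a second entry for \<open>a\<close>.\<close>

lemma pmf_eq_pmf_of_list_Cons:
  assumes "finite (set_pmf M)" "0 \<le> v" "v \<le> pmf M a"
  shows "\<exists>rest. pmf_of_list_wf ((a, v) # rest) \<and> pmf_of_list ((a, v) # rest) = M"
proof -
  obtain xs where xs: "set xs = set_pmf M - {a}" "distinct xs"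
    using finite_distinct_list assms(1) by (metis finite_Diff)
  define rest where "rest = (a, pmf M a - v) # map (\<lambda>z. (z, pmf M z)) xs"
  have "(\<Sum>z\<leftarrow>xs. pmf M z) = (\<Sum>z\<in>set_pmf M - {a}. pmf M z)"
    using xs by (simp add: sum_list_distinct_conv_sum_set)
  \<comment> \<open>\<open>a\<close> may lie outside the support when \<open>v = 0\<close>, hence
    the sum over \<open>insert a (set_pmf M)\<close>.\<close>
  moreover have "pmf M a + (\<Sum>z\<in>set_pmf M - {a}. pmf M z) = (\<Sum>z\<in>insert a (set_pmf M). pmf M z)"
    using assms(1) by (simp add: sum.insert_remove)
  moreover have "\<dots> = 1"
    using assms(1) by (intro sum_pmf_eq_1) auto
  ultimately have wf: "pmf_of_list_wf ((a, v) # rest)"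
    using assms by (auto simp: pmf_of_list_wf_def rest_def o_def)
  have "pmf (pmf_of_list ((a, v) # rest)) z = pmf M z" for z
  proof -
    have "sum_list (map snd (filter (\<lambda>y. fst y = z) (map (\<lambda>z. (z, pmf M z)) xs))) =
        (\<Sum>y\<leftarrow>filter (\<lambda>y. y = z) xs. pmf M y)"
      by (simp add: filter_map o_def)
    also have "\<dots> = (\<Sum>y\<in>set xs \<inter> {z}. pmf M y)"
      using xs(2) by (simp add: sum_list_distinct_conv_sum_set Int_def)
    also have "\<dots> = (if z = a then 0 else pmf M z)"
      using xs(1) by (cases "z \<in> set xs") (auto simp: set_pmf_iff)
    finally show ?thesis
      by (auto simp: rest_def pmf_pmf_of_list[OF wf[unfolded rest_def]])
  qed
  then show ?thesis using wf by (blast intro: pmf_eqI)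
qed


section \<open>Covering chains of maximal configurations are runs\<close>

text \<open>A covering chain without its family of sets: these are forced to be the sets of prefixes
  of \<open>es\<close>, and \<open>distinct\<close> expresses that each added event is new.\<close>

definition chain :: "('e, 'l) es \<Rightarrow> 'e list \<Rightarrow> bool" where
  "chain S es \<longleftrightarrow> distinct es \<and> (\<forall>ys zs. es = ys @ zs \<longrightarrow> configuration S (set ys))"

lemma chainD:
  assumes "chain S es"
  shows "distinct es" "es = ys @ zs \<Longrightarrow> configuration S (set ys)" "configuration S (set es)"
  using assms by (auto simp: chain_def)

lemma covering_chain_imp_chain:
  assumes "covering_chain S es x"
  shows "chain S es \<and> x = set es"
proof -
  obtain X where X: "X 0 = {}" "X (length es) = x" "\<And>i. i \<le> length es \<Longrightarrow> configuration S (X i)"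
    "\<And>i. i < length es \<Longrightarrow> es ! i \<notin> X i \<and> X (Suc i) = insert (es ! i) (X i)"
    using assms by (auto simp: covering_chain_def)
  have *: "X i = set (take i es) \<and> distinct (take i es)" if "i \<le> length es" for i
    using that
  proof (induction i)
    case 0
    then show ?case using X by simp
  next
    case (Suc i)
    then show ?case using X(4)[of i] by (auto simp: take_Suc_conv_app_nth)
  qed
  have "configuration S (set ys)" if "es = ys @ zs" for ys zs
    using *[of "length ys"] X(3)[of "length ys"] that by simp
  then show ?thesis using *[of "length es"] X(2) by (auto simp: chain_def)
qed

text \<open>A prefix of \<open>es @ [e]\<close> is the whole list or a prefix of \<open>es\<close>.
  This prepares induction from the right.\<close>

lemma chain_snoc:
  "chain S (es @ [e]) \<longleftrightarrow> chain S es \<and> e \<notin> set es \<and> configuration S (insert e (set es))"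
proof -
  have "(\<exists>zs. es @ [e] = ys @ zs) \<longleftrightarrow> ys = es @ [e] \<or> (\<exists>zs. es = ys @ zs)" for ys
    by (metis append_Nil2 append_assoc butlast_append butlast_snoc)
  then have "(\<forall>ys zs. es @ [e] = ys @ zs \<longrightarrow> configuration S (set ys)) \<longleftrightarrow>
      configuration S (insert e (set es)) \<and> (\<forall>ys zs. es = ys @ zs \<longrightarrow> configuration S (set ys))"
    by (metis list.simps(15) Un_insert_right append_Nil2 set_append sup_bot_right empty_set)
  then show ?thesis by (auto simp: chain_def)
qed

lemma chain_Nil: "chain S [] \<longleftrightarrow> configuration S {}"
  by (simp add: chain_def)

lemma configuration_empty: "configuration S {}"
  by (simp add: configuration_def)

text \<open>Transfers a chain of a composite structure to a component: \<open>f\<close> tags the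
  events of the component, and \<open>us\<close> lists the events that come before them.\<close>

lemma chain_mapD:
  assumes "chain S (us @ map f es)"
    and "\<And>y. configuration S (set us \<union> f ` y) \<Longrightarrow> configuration S' y"
  shows "chain S' es"
  using assms(1)
proof (induction es rule: rev_induct)
  case Nil
  then show ?case by (simp add: chain_Nil configuration_empty)
next
  case (snoc e es)
  have "configuration S (set us \<union> f ` insert e (set es))"
    using snoc.prems by (auto dest: chainD(3))
  then show ?case
    using snoc assms(2) by (auto simp: chain_snoc simp flip: append_assoc)
qed

lemma map_obtain:
  assumes "set xs \<subseteq> range f"
  obtains ys where "xs = map f ys"
  using assms ex_map_conv[of xs f] by blast

lemma maximal_configurationD:
  assumes "maximal_configuration S x"
  shows "configuration S x" "configuration S y \<Longrightarrow> x \<subseteq> y \<Longrightarrow> y = x"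
  using assms by (auto simp: maximal_configuration_def)

text \<open>Ensures that a maximal configuration of a choice goes beyond \<open>Init\<close>, and
  that one of a sequence enters the second component: otherwise a single event could be
  added.\<close>

lemma configuration_singleton_ex: "\<exists>e. configuration (interp_es C) {e}"
proof (induction C)
  case (Seq C1 C2)
  then obtain e where "configuration (interp_es C1) {e}" by auto
  then have "configuration (interp_es (Seq C1 C2)) {L e}"
    by (auto simp: configuration_def es_seq_def)
  then show ?case ..
next
  case (Par C1 C2)
  then obtain e where "configuration (interp_es C1) {e}" by auto
  then have "configuration (interp_es (Par C1 C2)) {L e}"
    by (auto simp: configuration_def es_par_def)
  then show ?case ..
next
  case (Choice p C1 C2)
  have "configuration (interp_es (Choice p C1 C2)) {Init}"
    by (auto simp: configuration_def es_choice_def)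
  then show ?case ..
qed (auto simp: configuration_def es_point_def)


subsection \<open>Single events\<close>

lemma maximal_chain_point:
  assumes "maximal_configuration (es_point l) (set es)" "chain (es_point l) es"
  shows "es = [Pt]"
proof -
  have "configuration (es_point l) {Pt}"
    by (auto simp: configuration_def es_point_def)
  moreover have "set es \<subseteq> {Pt}"
    using maximal_configurationD(1)[OF assms(1)] by (auto simp: configuration_def es_point_def)
  ultimately have "set es = {Pt}"
    using maximal_configurationD(2)[OF assms(1)] by metis
  then have "length es = Suc 0"
    using distinct_card[OF chainD(1)[OF assms(2)]] by simp
  then obtain e where "es = [e]"
    by (cases es) auto
  then show ?thesis
    using \<open>set es = {Pt}\<close> by simp
qed


subsection \<open>Parallel composition\<close>

lemma es_par_simps:
  "events (es_par S1 S2) = L ` events S1 \<union> R ` events S2"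
  "(c, L e) \<in> leq (es_par S1 S2) \<longleftrightarrow> (\<exists>d. c = L d \<and> (d, e) \<in> leq S1)"
  "(c, R e) \<in> leq (es_par S1 S2) \<longleftrightarrow> (\<exists>d. c = R d \<and> (d, e) \<in> leq S2)"
  "(c, L e) \<in> cfl (es_par S1 S2) \<longleftrightarrow> (\<exists>d. c = L d \<and> (d, e) \<in> cfl S1)"
  "(c, R e) \<in> cfl (es_par S1 S2) \<longleftrightarrow> (\<exists>d. c = R d \<and> (d, e) \<in> cfl S2)"
  by (auto simp: es_par_def)

text \<open>No order or conflict links the two tags, so the conditions split into one for each
  side.\<close>

lemma configuration_par:
  "configuration (es_par S1 S2) x \<longleftrightarrow>
    x \<subseteq> range L \<union> range R \<and> configuration S1 (L -` x) \<and> configuration S2 (R -` x)"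
proof (cases "x \<subseteq> range L \<union> range R")
  case True
  have "configuration (es_par S1 S2) (L ` y1 \<union> R ` y2) \<longleftrightarrow>
      configuration S1 y1 \<and> configuration S2 y2" for y1 y2
    unfolding configuration_def
    by (simp add: es_par_simps ball_Un image_subset_iff image_iff imp_ex imp_conjL
        all_conj_distrib) blast
  moreover have "x = L ` (L -` x) \<union> R ` (R -` x)"
    using True by blast
  ultimately show ?thesis
    using True by metis
next
  case False
  then show ?thesis unfolding configuration_def es_par_simps by blast
qed

text \<open>A larger configuration on one side, joined with the given part of the other side, would
  enlarge \<open>x\<close>.\<close>

lemma maximal_configuration_par:
  assumes "maximal_configuration (es_par S1 S2) x"
  shows "maximal_configuration S1 (L -` x)" "maximal_configuration S2 (R -` x)"
proof -
  have c: "configuration S1 (L -` x)" "configuration S2 (R -` x)" and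
    x: "x \<subseteq> range L \<union> range R"
    using maximal_configurationD(1)[OF assms] by (auto simp: configuration_par)
  have preimage: "L -` (L ` y1 \<union> R ` y2) = y1" "R -` (L ` y1 \<union> R ` y2) = y2" for y1 y2
    by auto
  have "configuration (es_par S1 S2) (L ` y1 \<union> R ` y2)"
    if "configuration S1 y1" "configuration S2 y2" for y1 y2
    unfolding configuration_par preimage using that by auto
  note max = maximal_configurationD(2)[OF assms this]
  show "maximal_configuration S1 (L -` x)"
    unfolding maximal_configuration_def
  proof (intro conjI allI impI c)
    fix y assume y: "configuration S1 y" "L -` x \<subseteq> y"
    have "L ` y \<union> R ` (R -` x) = x"
      using y(2) x by (intro max y(1) c(2)) blast
    then show "y = L -` x" using preimage(1) by metis
  qed
  show "maximal_configuration S2 (R -` x)"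
    unfolding maximal_configuration_def
  proof (intro conjI allI impI c)
    fix y assume y: "configuration S2 y" "R -` x \<subseteq> y"
    have "L ` (L -` x) \<union> R ` y = x"
      using y(2) x by (intro max y(1) c(1)) blast
    then show "y = R -` x" using preimage(2) by metis
  qed
qed

text \<open>\<open>shuffles\<close> recurses at the front of the lists, whereas chains grow at the
  end.\<close>

lemma shuffles_snoc:
  assumes "zs \<in> shuffles xs ys"
  shows "zs @ [z] \<in> shuffles (xs @ [z]) ys" "zs @ [z] \<in> shuffles xs (ys @ [z])"
proof -
  \<comment> \<open>This fact and its mirror image settle the cases of the induction in which one
    list is empty.\<close>
  have "xs @ [z] \<in> shuffles xs [z]" for xs
    by (induction xs) auto
  moreover from this have "xs @ [z] \<in> shuffles [z] xs" for xs
    by (simp add: shuffles_commutes)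
  ultimately show "zs @ [z] \<in> shuffles (xs @ [z]) ys" "zs @ [z] \<in> shuffles xs (ys @ [z])"
    using assms by (induction xs ys arbitrary: zs rule: shuffles.induct) auto
qed

lemma shuffles_map:
  "zs \<in> shuffles xs ys \<Longrightarrow> map f zs \<in> shuffles (map f xs) (map f ys)"
  by (induction xs ys arbitrary: zs rule: shuffles.induct) auto

text \<open>By induction from the right: the tag of the new event shows which component chain it
  extends.\<close>

lemma chain_par:
  assumes "chain (es_par S1 S2) es"
  shows "\<exists>es1 es2. es \<in> shuffles (map L es1) (map R es2) \<and> chain S1 es1 \<and> chain S2 es2"
  using assms
proof (induction es rule: rev_induct)
  case Nil
  then show ?case by (intro exI[of _ "[]"]) (simp add: chain_Nil configuration_empty)
next
  case (snoc e es)
  then obtain es1 es2 where es: "es \<in> shuffles (map L es1) (map R es2)" "chain S1 es1" "chain S2 es2"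
    by (auto simp: chain_snoc)
  have set: "set es = L ` set es1 \<union> R ` set es2"
    using set_shuffles[OF es(1)] by simp
  have c: "configuration (es_par S1 S2) (insert e (set es))" "e \<notin> set es"
    using snoc.prems by (auto simp: chain_snoc)
  then consider d where "e = L d" | d where "e = R d"
    by (auto simp: configuration_par)
  then show ?case
  proof cases
    case 1
    have "L -` insert e (set es) = insert d (set es1)"
      using 1 set by auto
    then have "chain S1 (es1 @ [d])"
      using c es 1 set by (auto simp: chain_snoc configuration_par)
    then show ?thesis
      using es shuffles_snoc(1)[OF es(1), of e] 1
      by (intro exI[of _ "es1 @ [d]"] exI[of _ es2]) auto
  next
    case 2
    have "R -` insert e (set es) = insert d (set es2)"
      using 2 set by auto
    then have "chain S2 (es2 @ [d])"
      using c es 2 set by (auto simp: chain_snoc configuration_par)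
    then show ?thesis
      using es shuffles_snoc(2)[OF es(1), of e] 2
      by (intro exI[of _ es1] exI[of _ "es2 @ [d]"]) auto
  qed
qed


subsection \<open>Probabilistic choice\<close>

lemma es_choice_simps:
  "events (es_choice S1 S2) = {Init} \<union> L ` events S1 \<union> R ` events S2"
  "(c, Init) \<in> leq (es_choice S1 S2) \<longleftrightarrow> c = Init"
  "(c, L e) \<in> leq (es_choice S1 S2) \<longleftrightarrow>
    c = Init \<and> e \<in> events S1 \<or> (\<exists>d. c = L d \<and> (d, e) \<in> leq S1)"
  "(c, R e) \<in> leq (es_choice S1 S2) \<longleftrightarrow>
    c = Init \<and> e \<in> events S2 \<or> (\<exists>d. c = R d \<and> (d, e) \<in> leq S2)"
  "(Init, c) \<notin> cfl (es_choice S1 S2)"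
  "(c, Init) \<notin> cfl (es_choice S1 S2)"
  "(L d, L e) \<in> cfl (es_choice S1 S2) \<longleftrightarrow> (d, e) \<in> cfl S1"
  "(R d, R e) \<in> cfl (es_choice S1 S2) \<longleftrightarrow> (d, e) \<in> cfl S2"
  "(L d, R e) \<in> cfl (es_choice S1 S2) \<longleftrightarrow> d \<in> events S1 \<and> e \<in> events S2"
  by (auto simp: es_choice_def)

lemma configuration_choiceL:
  "configuration (es_choice S1 S2) (insert Init (L ` y)) \<longleftrightarrow> configuration S1 y"
  unfolding configuration_def by (auto simp: es_choice_simps)

lemma configuration_choiceR:
  "configuration (es_choice S1 S2) (insert Init (R ` y)) \<longleftrightarrow> configuration S2 y"
  unfolding configuration_def by (auto simp: es_choice_simps)

text \<open>\<open>Init\<close> lies below all events and so comes first, and the conflict between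
  the sides confines the rest to one of them. The hypothesis on \<open>e\<close> prevents
  \<open>{Init}\<close> from being maximal; that the lists are nonempty later selects the case of
  \<open>interp_val\<close>.\<close>

lemma maximal_chain_choice:
  assumes max: "maximal_configuration (es_choice S1 S2) (set es)"
    and ch: "chain (es_choice S1 S2) es" and ne: "configuration S1 {e}"
  obtains (left) es1 where "es = Init # map L es1" "es1 \<noteq> []"
    "maximal_configuration S1 (set es1)" "chain S1 es1"
  | (right) es2 where "es = Init # map R es2" "es2 \<noteq> []"
    "maximal_configuration S2 (set es2)" "chain S2 es2"
proof -
  let ?S = "es_choice S1 S2"
  have conf: "configuration ?S (set es)"
    using max by (rule maximal_configurationD)
  have "configuration ?S {Init, L e}"
    using configuration_choiceL[of S1 S2 "{e}"] ne by simp
  then have not: "set es \<noteq> {}" "set es \<noteq> {Init}"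
    using maximal_configurationD(2)[OF max, of "{Init, L e}"] by auto
  then obtain a es' where es: "es = a # es'"
    by (cases es) auto
  have "configuration ?S {a}"
    using chainD(2)[OF ch, of "[a]" es'] es by simp
  then have a: "a = Init"
    by (auto simp: configuration_def es_choice_def)
  have sub: "set es' \<subseteq> L ` events S1 \<union> R ` events S2"
    using conf es a chainD(1)[OF ch] by (auto simp: configuration_def es_choice_simps)
  have "es' \<noteq> []" using not es a by auto
  have nocfl: "\<not> (L d \<in> set es' \<and> R d' \<in> set es')" for d d'
  proof
    assume "L d \<in> set es' \<and> R d' \<in> set es'"
    moreover from this have "(L d, R d') \<in> cfl ?S"
      using sub by (auto simp: es_choice_simps)
    ultimately show False
      using conf es unfolding configuration_def by auto
  qed
  show ?thesis
  proof (cases "set es' \<subseteq> range L")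
    case True
    then obtain es1 where es1: "es' = map L es1" by (rule map_obtain)
    have "maximal_configuration S1 (set es1)"
      unfolding maximal_configuration_def
    proof (intro conjI allI impI)
      show "configuration S1 (set es1)"
        using conf es a es1 by (simp add: configuration_choiceL)
      fix y assume "configuration S1 y" "set es1 \<subseteq> y"
      then have "insert Init (L ` y) = set es"
        using es a es1 by (intro maximal_configurationD(2)[OF max]) (auto simp: configuration_choiceL)
      then show "y = set es1"
        using es a es1 by auto
    qed
    moreover have "chain S1 es1"
      by (rule chain_mapD[of ?S "[Init]" L]) (use ch es a es1 in \<open>auto simp: configuration_choiceL\<close>)
    ultimately show ?thesis
      using \<open>es' \<noteq> []\<close> es a es1 by (intro left[of es1]) auto
  next
    case False
    then have "set es' \<subseteq> range R" using nocfl sub by blast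
    then obtain es1 where es1: "es' = map R es1" by (rule map_obtain)
    have "maximal_configuration S2 (set es1)"
      unfolding maximal_configuration_def
    proof (intro conjI allI impI)
      show "configuration S2 (set es1)"
        using conf es a es1 by (simp add: configuration_choiceR)
      fix y assume "configuration S2 y" "set es1 \<subseteq> y"
      then have "insert Init (R ` y) = set es"
        using es a es1 by (intro maximal_configurationD(2)[OF max]) (auto simp: configuration_choiceR)
      then show "y = set es1"
        using es a es1 by auto
    qed
    moreover have "chain S2 es1"
      by (rule chain_mapD[of ?S "[Init]" R]) (use ch es a es1 in \<open>auto simp: configuration_choiceR\<close>)
    ultimately show ?thesis
      using \<open>es' \<noteq> []\<close> es a es1 by (intro right[of es1]) auto
  qed
qed


subsection \<open>Sequential composition\<close>

lemma es_seq_simps: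
  "events (es_seq S1 S2) = L ` events S1 \<union>
    {After e x |e x. e \<in> events S2 \<and> maximal_configuration S1 (fset x)}"
  "(c, L e) \<in> leq (es_seq S1 S2) \<longleftrightarrow> (\<exists>d. c = L d \<and> (d, e) \<in> leq S1)"
  "(c, After e x) \<in> leq (es_seq S1 S2) \<longleftrightarrow> maximal_configuration S1 (fset x) \<and>
    ((\<exists>d. c = L d \<and> d |\<in>| x \<and> e \<in> events S2) \<or> (\<exists>d. c = After d x \<and> (d, e) \<in> leq S2))"
  "(L d, L e) \<in> cfl (es_seq S1 S2) \<longleftrightarrow> (d, e) \<in> cfl S1"
  "(L d, After e x) \<in> cfl (es_seq S1 S2) \<longleftrightarrow>
    e \<in> events S2 \<and> maximal_configuration S1 (fset x) \<and> (\<exists>c. c |\<in>| x \<and> (d, c) \<in> cfl S1)"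
  "(After e x, L d) \<in> cfl (es_seq S1 S2) \<longleftrightarrow>
    e \<in> events S2 \<and> maximal_configuration S1 (fset x) \<and> (\<exists>c. c |\<in>| x \<and> (c, d) \<in> cfl S1)"
  "(After d x, After e x) \<in> cfl (es_seq S1 S2) \<longleftrightarrow> maximal_configuration S1 (fset x) \<and>
    ((d, e) \<in> cfl S2 \<or>
      d \<in> events S2 \<and> e \<in> events S2 \<and> (\<exists>b c. b |\<in>| x \<and> c |\<in>| x \<and> (b, c) \<in> cfl S1))"
  by (auto simp: es_seq_def)

lemma configuration_seq_L:
  "configuration (es_seq S1 S2) (L ` y) \<longleftrightarrow> configuration S1 y"
  unfolding configuration_def by (auto simp: es_seq_simps)

lemma configuration_seq_vimage:
  assumes "configuration (es_seq S1 S2) x"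
  shows "configuration S1 (L -` x)"
proof -
  have c: "x \<subseteq> events (es_seq S1 S2)"
    "\<And>e d. e \<in> x \<Longrightarrow> (d, e) \<in> leq (es_seq S1 S2) \<Longrightarrow> d \<in> x"
    "\<And>e d. e \<in> x \<Longrightarrow> d \<in> x \<Longrightarrow> (e, d) \<notin> cfl (es_seq S1 S2)"
    using assms unfolding configuration_def by blast+
  have "L -` x \<subseteq> events S1"
    using c(1) by (auto simp: es_seq_simps)
  moreover have "d \<in> L -` x" if "e \<in> L -` x" "(d, e) \<in> leq S1" for d e
    using c(2)[of "L e" "L d"] that by (simp add: es_seq_simps)
  moreover have "(e, d) \<notin> cfl S1" if "e \<in> L -` x" "d \<in> L -` x" for d e
    using c(3)[of "L e" "L d"] that by (simp add: es_seq_simps)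
  ultimately show ?thesis unfolding configuration_def by blast
qed

lemma configuration_seq_After:
  assumes "configuration (es_seq S1 S2) x" "After e z \<in> x"
  shows "maximal_configuration S1 (fset z)" "fset z = L -` x"
proof -
  have e: "e \<in> events S2" "maximal_configuration S1 (fset z)"
    using assms by (auto simp: configuration_def es_seq_simps)
  then show "maximal_configuration S1 (fset z)" by simp
  have "(L d, After e z) \<in> leq (es_seq S1 S2)" if "d |\<in>| z" for d
    using that e by (simp add: es_seq_simps)
  then have "fset z \<subseteq> L -` x"
    using assms unfolding configuration_def by blast
  then show "fset z = L -` x"
    using maximal_configurationD(2)[OF e(2) configuration_seq_vimage[OF assms(1)]] by simp
qed

lemma configuration_seq_union:
  assumes "maximal_configuration S1 (fset z)"
  shows "configuration (es_seq S1 S2) (L ` fset z \<union> (\<lambda>e. After e z) ` y) \<longleftrightarrow> configuration S2 y"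
proof -
  have "configuration S1 (fset z)" using assms by (rule maximal_configurationD)
  then show ?thesis
    using assms unfolding configuration_def
    by (simp add: es_seq_simps ball_Un image_subset_iff image_iff imp_ex imp_conjL
        all_conj_distrib) auto
qed

text \<open>An event \<open>After e z\<close> has all of \<open>z\<close> below it, so a chain
  completes one maximal configuration of \<open>S1\<close> before it enters a copy of
  \<open>S2\<close>.\<close>

lemma maximal_chain_seq:
  assumes max: "maximal_configuration (es_seq S1 S2) (set es)"
    and ch: "chain (es_seq S1 S2) es" and ne: "configuration S2 {e}"
  obtains es1 es2 z where "es = map L es1 @ map (\<lambda>e. After e z) es2" "es2 \<noteq> []"
    "maximal_configuration S1 (set es1)" "chain S1 es1"
    "maximal_configuration S2 (set es2)" "chain S2 es2"
proof -
  let ?S = "es_seq S1 S2"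
  have conf: "configuration ?S (set es)"
    using max by (rule maximal_configurationD)
  define us where "us = takeWhile (\<lambda>e. e \<in> range L) es"
  define ws where "ws = dropWhile (\<lambda>e. e \<in> range L) es"
  have es: "es = us @ ws" by (simp add: us_def ws_def)
  have "set us \<subseteq> range L" by (auto simp: us_def dest: set_takeWhileD)
  then obtain es1 where es1: "us = map L es1" by (rule map_obtain)
  \<comment> \<open>Otherwise \<open>es1\<close> would exhaust a maximal configuration of
    \<open>S1\<close>, and \<open>After e z\<close> could still be added to
    \<open>es\<close>.\<close>
  have "ws \<noteq> []"
  proof
    assume "ws = []"
    then have es_L: "set es = L ` set es1" using es es1 by simp
    have max1: "maximal_configuration S1 (set es1)"
      unfolding maximal_configuration_def
    proof (intro conjI allI impI)
      show "configuration S1 (set es1)"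
        using conf es_L by (simp add: configuration_seq_L)
      fix y assume "configuration S1 y" "set es1 \<subseteq> y"
      then have "L ` y = set es"
        using es_L by (intro maximal_configurationD(2)[OF max]) (auto simp: configuration_seq_L)
      then show "y = set es1" using es_L by auto
    qed
    define z where "z = fset_of_list es1"
    have z: "fset z = set es1" by (simp add: z_def fset_of_list.rep_eq)
    then have "configuration ?S (L ` set es1 \<union> (\<lambda>e. After e z) ` {e})"
      using configuration_seq_union[of S1 z S2 "{e}"] max1 ne by simp
    then have "L ` set es1 \<union> (\<lambda>e. After e z) ` {e} = set es"
      using es_L by (intro maximal_configurationD(2)[OF max]) auto
    then show False using es_L by auto
  qed
  then obtain w ws' where ws: "ws = w # ws'" by (cases ws) auto
  have "w \<notin> range L" using ws by (auto simp: ws_def dropWhile_eq_Cons_conv)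
  moreover have "w \<in> events ?S" using conf es ws by (auto simp: configuration_def)
  ultimately obtain e' z where w: "w = After e' z" by (auto simp: es_seq_def)
  have max1: "maximal_configuration S1 (fset z)" and z: "fset z = L -` set es"
    using configuration_seq_After[OF conf, of e' z] es ws w by auto
  \<comment> \<open>The prefix that ends with \<open>w\<close> already contains all of
    \<open>z\<close>, which identifies \<open>z\<close> with the events of
    \<open>es1\<close>.\<close>
  have "configuration ?S (set (us @ [w]))"
    using chainD(2)[OF ch, of "us @ [w]" ws'] es ws by simp
  then have "fset z = L -` set (us @ [w])"
    using configuration_seq_After(2)[of S1 S2 "set (us @ [w])" e' z] w by simp
  then have z1: "fset z = set es1"
    using es1 w by auto
  have "c \<in> range (\<lambda>e. After e z)" if "c \<in> set ws" for c
  proof -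
    have c: "c \<in> set es" using that es by simp
    then have "c \<in> events ?S" using conf by (auto simp: configuration_def)
    then consider d where "c = L d" | d z' where "c = After d z'"
      by (auto simp: es_seq_def)
    then show ?thesis
    proof cases
      case 1
      \<comment> \<open>A later \<open>L\<close> event would belong to \<open>z\<close>, hence
        already to \<open>us\<close>, contrary to distinctness.\<close>
      then have "d \<in> set es1" using c z z1 by auto
      then have "c \<in> set us" using 1 es1 by simp
      then show ?thesis using that es chainD(1)[OF ch] by auto
    next
      case 2
      then show ?thesis using configuration_seq_After(2)[OF conf, of d z'] c z
        by (auto simp: fset_inject)
    qed
  qed
  then have "set ws \<subseteq> range (\<lambda>e. After e z)" by blast
  then obtain es2 where es2: "ws = map (\<lambda>e. After e z) es2"
    by (rule map_obtain)
  have set_es: "set es = L ` fset z \<union> (\<lambda>e. After e z) ` set es2"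
    using es es1 es2 z1 by simp
  have After_preimage: "{e. After e z \<in> L ` A \<union> (\<lambda>e. After e z) ` y} = y" for A y
    by auto
  have "maximal_configuration S2 (set es2)"
    unfolding maximal_configuration_def
  proof (intro conjI allI impI)
    show "configuration S2 (set es2)"
      using conf configuration_seq_union[OF max1] set_es by simp
    fix y assume "configuration S2 y" "set es2 \<subseteq> y"
    then have "L ` fset z \<union> (\<lambda>e. After e z) ` y = set es"
      using set_es configuration_seq_union[OF max1]
      by (intro maximal_configurationD(2)[OF max]) auto
    then have "L ` fset z \<union> (\<lambda>e. After e z) ` y = L ` fset z \<union> (\<lambda>e. After e z) ` set es2"
      using set_es by (rule trans)
    then show "y = set es2" using After_preimage by metis
  qed
  moreover have "chain S2 es2"
  proof (rule chain_mapD)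
    show "chain ?S (us @ map (\<lambda>e. After e z) es2)"
      using ch es es2 by simp
    show "configuration S2 y" if "configuration ?S (set us \<union> (\<lambda>e. After e z) ` y)" for y
      using that configuration_seq_union[OF max1, of S2 y] by (simp add: es1 z1)
  qed
  moreover have "chain S1 es1"
  proof (rule chain_mapD)
    show "chain ?S ([] @ map L es1)"
      using ch es es1 by (simp add: chain_def)
    show "configuration S1 y" if "configuration ?S (set [] \<union> L ` y)" for y
      using that by (simp add: configuration_seq_L)
  qed
  moreover have "es2 \<noteq> []" "maximal_configuration S1 (set es1)"
    using \<open>ws \<noteq> []\<close> es2 max1 z1 by auto
  ultimately show ?thesis
    using es es1 es2 by (intro that[of es1 z es2]) simp_all
qed


subsection \<open>All commands\<close>

text \<open>The valuation is matched exactly here; inequalities arise only on the operational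
  side.\<close>

lemma maximal_chain_imp_run:
  assumes "maximal_configuration (interp_es C) (set es)" "chain (interp_es C) es"
  shows "run C (map (lab (interp_es C)) es) (interp_val C (set es))"
  using assms
proof (induction C arbitrary: es)
  case Skip
  then have "es = [Pt]" by (auto dest: maximal_chain_point)
  then show ?case using maximal_configurationD(1)[OF Skip(1)] run_Skip
    by (auto simp: on_configurations_def es_point_def)
next
  case (Atom a)
  then have "es = [Pt]" by (auto dest: maximal_chain_point)
  then show ?case using maximal_configurationD(1)[OF Atom(1)] run_Atom
    by (auto simp: on_configurations_def es_point_def)
next
  case (Seq C1 C2)
  let ?S1 = "interp_es C1" and ?S2 = "interp_es C2"
  have conf: "configuration (es_seq ?S1 ?S2) (set es)"
    using maximal_configurationD(1)[OF Seq.prems(1)] by simp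
  obtain e where ne: "configuration ?S2 {e}" using configuration_singleton_ex by blast
  obtain es1 es2 z where d: "es = map L es1 @ map (\<lambda>e. After e z) es2" "es2 \<noteq> []"
    "maximal_configuration ?S1 (set es1)" "chain ?S1 es1"
    "maximal_configuration ?S2 (set es2)" "chain ?S2 es2"
    using Seq.prems unfolding interp_es.simps by (rule maximal_chain_seq[OF _ _ ne])
  \<comment> \<open>Since \<open>es2\<close> is nonempty, \<open>set es\<close> leaves
    \<open>range L\<close>, which selects the product case of \<open>interp_val\<close>.\<close>
  have "L -` set es = set es1" "{e. \<exists>y. After e y \<in> set es} = set es2" "\<not> set es \<subseteq> range L"
    using d by (auto simp: neq_Nil_conv)
  then have "interp_val (Seq C1 C2) (set es) = interp_val C1 (set es1) * interp_val C2 (set es2)"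
    using conf by (simp add: on_configurations_def)
  moreover have "map (lab (interp_es (Seq C1 C2))) es = map (lab ?S1) es1 @ map (lab ?S2) es2"
    using d by (simp add: es_seq_def)
  ultimately show ?case
    using run_Seq[OF Seq.IH(1)[OF d(3,4)] Seq.IH(2)[OF d(5,6)]] by metis
next
  case (Choice p C1 C2)
  let ?S1 = "interp_es C1" and ?S2 = "interp_es C2"
  have conf: "configuration (es_choice ?S1 ?S2) (set es)"
    using maximal_configurationD(1)[OF Choice.prems(1)] by simp
  obtain e where ne: "configuration ?S1 {e}" using configuration_singleton_ex by blast
  have "maximal_configuration (es_choice ?S1 ?S2) (set es)" "chain (es_choice ?S1 ?S2) es"
    using Choice.prems by auto
  then show ?case using ne
  proof (cases rule: maximal_chain_choice)
    case (left es1)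
    have "L -` set es = set es1" "\<not> set es \<subseteq> {Init}" "set es \<subseteq> insert Init (range L)"
      using left by (auto simp: neq_Nil_conv)
    then have "interp_val (Choice p C1 C2) (set es) = weight p * interp_val C1 (set es1)"
      using conf by (simp add: on_configurations_def)
    moreover have "map (lab (interp_es (Choice p C1 C2))) es = Tau # map (lab ?S1) es1"
      using left by (simp add: es_choice_def)
    ultimately show ?thesis
      using run_ChoiceL[OF Choice.IH(1)[OF left(3,4)]] by metis
  next
    case (right es2)
    have "R -` set es = set es2" "\<not> set es \<subseteq> {Init}" "\<not> set es \<subseteq> insert Init (range L)"
      using right by (auto simp: neq_Nil_conv)
    then have "interp_val (Choice p C1 C2) (set es) = (1 - weight p) * interp_val C2 (set es2)"
      using conf by (simp add: on_configurations_def)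
    moreover have "map (lab (interp_es (Choice p C1 C2))) es = Tau # map (lab ?S2) es2"
      using right by (simp add: es_choice_def)
    ultimately show ?thesis
      using run_ChoiceR[OF Choice.IH(2)[OF right(3,4)]] by metis
  qed
next
  case (Par C1 C2)
  let ?S1 = "interp_es C1" and ?S2 = "interp_es C2"
  let ?lab = "lab (interp_es (Par C1 C2))"
  obtain es1 es2 where d: "es \<in> shuffles (map L es1) (map R es2)" "chain ?S1 es1" "chain ?S2 es2"
    using chain_par Par.prems(2) by fastforce
  have pre: "L -` set es = set es1" "R -` set es = set es2"
    using set_shuffles[OF d(1)] by auto
  have max: "maximal_configuration (es_par ?S1 ?S2) (set es)"
    using Par.prems(1) by simp
  have "map ?lab es \<in> shuffles (map ?lab (map L es1)) (map ?lab (map R es2))"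
    using d(1) by (rule shuffles_map)
  then have "map ?lab es \<in> shuffles (map (lab ?S1) es1) (map (lab ?S2) es2)"
    by (simp add: es_par_def o_def)
  moreover have "interp_val (Par C1 C2) (set es) = interp_val C1 (set es1) * interp_val C2 (set es2)"
    using maximal_configurationD(1)[OF max] by (simp add: on_configurations_def pre)
  ultimately show ?case
    using run_Par[OF Par.IH(1)[OF _ d(2)] Par.IH(2)[OF _ d(3)]] maximal_configuration_par[OF max]
    by (metis pre)
qed

theorem mainTheorem4:
  fixes C :: "'a cmd" and x\<^sub>0 :: "ev set" and es :: "ev list" and \<omega>\<^sub>0 :: "'a label list"
  assumes "maximal_configuration (interp_es C) x\<^sub>0"
    and "covering_chain (interp_es C) es x\<^sub>0"
    and "\<omega>\<^sub>0 = map (lab (interp_es C)) es"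
  shows "\<exists>rest :: (('a label list \<times> 'a cmd option) \<times> real) list.
           pmf_of_list_wf (((\<omega>\<^sub>0, None), interp_val C x\<^sub>0) # rest) \<and>
           multi C (pmf_of_list (((\<omega>\<^sub>0, None), interp_val C x\<^sub>0) # rest))"
proof -
  have run: "run C \<omega>\<^sub>0 (interp_val C x\<^sub>0)"
    using assms covering_chain_imp_chain[OF assms(2)] maximal_chain_imp_run by metis
  obtain M where M: "multi C M" "finite (set_pmf M)" "interp_val C x\<^sub>0 \<le> pmf M (\<omega>\<^sub>0, None)"
    using run_imp_multi[OF run] by auto
  then show ?thesis
    using pmf_eq_pmf_of_list_Cons[OF M(2) run_nonneg[OF run] M(3)] by metis
qed

end
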